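(* Let $\mathbf{B}=\{z=(z_j)_{j\ge1}\in\mathbb{D}^\infty: z_j\to0\}$ be the open unit ball of $c_0$, and let $\phi=(\phi_j)_{j\ge1}:\mathbf{B}\to\mathbf{B}$ be an analytic map such that $C_\phi f=f\circ\phi$ maps $A^+(\mathbb{T}^\infty)$ into itself. Then: (a) If $\phi(z)=(\epsilon_jz_{\sigma(j)})_{j\ge1}$ for some permutation $\sigma$ of $\mathbb{N}$ and some sequence $(\epsilon_j)_{j\ge1}$ of complex numbers of modulus $1$, then $C_\phi$ is an automorphism of $A^+(\mathbb{T}^\infty)$, and it is isometric. (b) If $C_\phi$ is an automorphism of $A^+(\mathbb{T}^\infty)$ and moreover, for each $k\in\mathbb{N}$, $\phi_k(z)=z_k^{d_k}u_k(z)$ for all $z\in\mathbf{B}$, with an integer $d_k\ge1$ and an analytic function $u_k$ on $\mathbf{B}$ with $u_k(0)\ne0$, then $\phi(z)=(\epsilon_jz_j)_{j\ge1}$ for some sequence $(\epsilon_j)_{j\ge1}$ of complex numbers of modulus $1$.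
   Context: $A^+(\mathbb{T}^\infty)$ is the algebra of functions $f(z)=\sum_{\alpha}a_\alpha z^\alpha$ on $\overline{\mathbb{D}}^\infty$, where $\alpha$ ranges over finitely supported sequences $(\alpha_1,\dots,\alpha_r,0,0,\dots)$ of non-negative integers, $z^\alpha=z_1^{\alpha_1}\cdots z_r^{\alpha_r}$, and $\|f\|_{A^+(\mathbb{T}^\infty)}=\sum_\alpha|a_\alpha|<\infty$; it is a commutative unital Banach algebra under pointwise multiplication. $\mathbf{B}$ carries the sup norm of $c_0$, and analyticity is in the sense of holomorphic maps on this Banach space. An automorphism is a bijective algebra homomorphism onto $A^+(\mathbb{T}^\infty)$. *)

theory Defs
  imports "HOL-Analysis.Analysis"
begin

text \<open>Points of the infinite polydisc are sequences indexed by nat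
  (index 0 here corresponds to the paper's index 1).\<close>

type_synonym seq = "nat \<Rightarrow> complex"

definition supnorm :: "seq \<Rightarrow> real" where
  "supnorm h = (SUP j. norm (h j))"

definition c0 :: "seq set" where
  "c0 = {h. (h \<longlonglongrightarrow> 0)}"

definition ballB :: "seq set" where
  "ballB = {z. (\<forall>j. norm (z j) < 1) \<and> (z \<longlonglongrightarrow> 0)}"

definition bounded_clinear_c0 :: "(seq \<Rightarrow> seq) \<Rightarrow> bool" where
  "bounded_clinear_c0 L \<longleftrightarrow>
     (\<forall>h\<in>c0. L h \<in> c0) \<and>
     (\<forall>a b h k. h \<in> c0 \<longrightarrow> k \<in> c0 \<longrightarrow>
         L (\<lambda>j. a * h j + b * k j) = (\<lambda>j. a * L h j + b * L k j)) \<and>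
     (\<exists>C. \<forall>h\<in>c0. supnorm (L h) \<le> C * supnorm h)"

definition bounded_clinear_functional_c0 :: "(seq \<Rightarrow> complex) \<Rightarrow> bool" where
  "bounded_clinear_functional_c0 L \<longleftrightarrow>
     (\<forall>a b h k. h \<in> c0 \<longrightarrow> k \<in> c0 \<longrightarrow>
         L (\<lambda>j. a * h j + b * k j) = a * L h + b * L k) \<and>
     (\<exists>C. \<forall>h\<in>c0. norm (L h) \<le> C * supnorm h)"

definition analytic_map_B :: "(seq \<Rightarrow> seq) \<Rightarrow> bool" where
  "analytic_map_B \<phi> \<longleftrightarrow>
     (\<forall>z\<in>ballB. \<phi> z \<in> c0) \<and>
     (\<forall>z\<in>ballB. \<exists>L. bounded_clinear_c0 L \<and>
        (\<forall>e>0. \<exists>d>0. \<forall>h\<in>c0. supnorm h < d \<longrightarrow>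
           supnorm (\<lambda>j. \<phi> (\<lambda>i. z i + h i) j - \<phi> z j - L h j) \<le> e * supnorm h))"

definition analytic_fun_B :: "(seq \<Rightarrow> complex) \<Rightarrow> bool" where
  "analytic_fun_B u \<longleftrightarrow>
     (\<forall>z\<in>ballB. \<exists>L. bounded_clinear_functional_c0 L \<and>
        (\<forall>e>0. \<exists>d>0. \<forall>h\<in>c0. supnorm h < d \<longrightarrow>
           norm (u (\<lambda>i. z i + h i) - u z - L h) \<le> e * supnorm h))"

definition MI :: "(nat \<Rightarrow> nat) set" where
  "MI = {\<alpha>. finite {j. \<alpha> j \<noteq> 0}}"

definition monom :: "seq \<Rightarrow> (nat \<Rightarrow> nat) \<Rightarrow> complex" where
  "monom z \<alpha> = (\<Prod>j\<in>{j. \<alpha> j \<noteq> 0}. z j ^ \<alpha> j)"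

text \<open>Elements of A^+(T^\<infinity>), represented by their restriction to B
  (set to 0 outside B, so that equality of elements is equality of functions).\<close>
definition Aplus_rep :: "((nat \<Rightarrow> nat) \<Rightarrow> complex) \<Rightarrow> (seq \<Rightarrow> complex) \<Rightarrow> bool" where
  "Aplus_rep a f \<longleftrightarrow>
     (\<forall>\<alpha>. \<alpha> \<notin> MI \<longrightarrow> a \<alpha> = 0) \<and>
     (\<lambda>\<alpha>. norm (a \<alpha>)) summable_on MI \<and>
     (\<forall>z. f z = (if z \<in> ballB then (\<Sum>\<^sub>\<infinity>\<alpha>\<in>MI. a \<alpha> * monom z \<alpha>) else 0))"

definition Aplus :: "(seq \<Rightarrow> complex) set" where
  "Aplus = {f. \<exists>a. Aplus_rep a f}"

definition Aplus_norm :: "(seq \<Rightarrow> complex) \<Rightarrow> real" where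
  "Aplus_norm f = (\<Sum>\<^sub>\<infinity>\<alpha>\<in>MI. norm ((SOME a. Aplus_rep a f) \<alpha>))"

definition Aplus_one :: "seq \<Rightarrow> complex" where
  "Aplus_one = (\<lambda>z. if z \<in> ballB then 1 else 0)"

definition comp_op :: "(seq \<Rightarrow> seq) \<Rightarrow> (seq \<Rightarrow> complex) \<Rightarrow> (seq \<Rightarrow> complex)" where
  "comp_op \<phi> f = (\<lambda>z. if z \<in> ballB then f (\<phi> z) else 0)"

definition Aplus_automorphism :: "((seq \<Rightarrow> complex) \<Rightarrow> (seq \<Rightarrow> complex)) \<Rightarrow> bool" where
  "Aplus_automorphism T \<longleftrightarrow>
     bij_betw T Aplus Aplus \<and>
     (\<forall>f\<in>Aplus. \<forall>g\<in>Aplus. T (\<lambda>z. f z + g z) = (\<lambda>z. T f z + T g z)) \<and>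
     (\<forall>f\<in>Aplus. \<forall>g\<in>Aplus. T (\<lambda>z. f z * g z) = (\<lambda>z. T f z * T g z)) \<and>
     (\<forall>c. \<forall>f\<in>Aplus. T (\<lambda>z. c * f z) = (\<lambda>z. c * T f z)) \<and>
     T Aplus_one = Aplus_one"

end

theory Submission
  imports Defs "HOL-Complex_Analysis.Conformal_Mappings"
begin

text \<open>For (a), a weighted permutation of the coordinates permutes the monomials up to unimodular
  factors, so everything reduces to the uniqueness of the coefficients.

  For (b), let \<open>C\<^sub>\<phi> f = z\<^sub>k\<close>. If \<open>|\<lambda>| > 1\<close>, then \<open>z\<^sub>k - \<lambda>\<close> is invertible in the algebra, hence so
  is \<open>f - \<lambda>\<close>; therefore \<open>|f| \<le> 1\<close>. Now \<open>\<phi>\<close> maps the \<open>k\<close>-th axis into itself by some \<open>p\<close> with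
  \<open>p(0) = 0\<close>, and the restriction \<open>h\<close> of \<open>f\<close> to this axis satisfies \<open>h \<circ> p = id\<close>. As \<open>|u\<^sub>k| \<le> 1\<close>
  by the maximum principle, the Schwarz lemma gives
  \<open>|t| = |h(p(t))| \<le> |p(t)| = |t|\<^sup>d |u\<^sub>k| \<le> |t|\<^sup>d\<close> on the axis. So \<open>d = 1\<close>, and \<open>|u\<^sub>k|\<close> attains its
  maximum \<open>1\<close> inside the ball, which makes \<open>u\<^sub>k\<close> constant.\<close>

hide_const (open) Polynomial.monom

section \<open>Absolutely convergent sums\<close>

lemma abs_summable_mult_Times:
  fixes f :: "'i \<Rightarrow> 'a::real_normed_div_algebra"
  assumes f: "(\<lambda>x. norm (f x)) summable_on A" and g: "(\<lambda>y. norm (g y)) summable_on B"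
  shows "(\<lambda>p. norm (f (fst p) * g (snd p))) summable_on A \<times> B"
proof (rule summable_on_SigmaI)
  show "((\<lambda>y. norm (f (fst (x, y)) * g (snd (x, y)))) has_sum
      norm (f x) * (\<Sum>\<^sub>\<infinity>y\<in>B. norm (g y))) B" for x
    using g by (simp add: norm_mult has_sum_cmult_right has_sum_infsum)
  show "(\<lambda>x. norm (f x) * (\<Sum>\<^sub>\<infinity>y\<in>B. norm (g y))) summable_on A"
    by (intro summable_on_cmult_left f)
qed simp

lemma has_sum_mult_Times:
  fixes f :: "'i \<Rightarrow> 'a::{real_normed_div_algebra, banach}"
  assumes f: "(\<lambda>x. norm (f x)) summable_on A" "(f has_sum s) A"
    and g: "(\<lambda>y. norm (g y)) summable_on B" "(g has_sum t) B"
  shows "((\<lambda>p. f (fst p) * g (snd p)) has_sum s * t) (A \<times> B)"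
proof (rule has_sum_SigmaI)
  show "((\<lambda>y. f (fst (x, y)) * g (snd (x, y))) has_sum f x * t) B" for x
    using g(2) by (simp add: has_sum_cmult_right)
  show "((\<lambda>x. f x * t) has_sum s * t) A"
    by (rule has_sum_cmult_left [OF f(2)])
  show "(\<lambda>p. f (fst p) * g (snd p)) summable_on A \<times> B"
    by (rule abs_summable_summable [OF abs_summable_mult_Times [OF f(1) g(1)]])
qed

lemma
  fixes c :: "'i \<Rightarrow> 'a::banach"
  assumes c: "(\<lambda>i. norm (c i)) summable_on I" and \<mu>: "\<mu> ` I \<subseteq> J"
  shows abs_summable_infsum_fibres:
      "(\<lambda>j. norm (\<Sum>\<^sub>\<infinity>i | i \<in> I \<and> \<mu> i = j. c i)) summable_on J"
    and has_sum_infsum_fibres: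
      "(c has_sum s) I \<Longrightarrow> ((\<lambda>j. \<Sum>\<^sub>\<infinity>i | i \<in> I \<and> \<mu> i = j. c i) has_sum s) J"
proof -
  let ?fibres = "SIGMA j:J. {i \<in> I. \<mu> i = j}"
  have bij: "bij_betw snd ?fibres I"
    by (rule bij_betw_byWitness [where f' = "\<lambda>i. (\<mu> i, i)"]) (use \<mu> in auto)
  have fibre: "(\<lambda>i. norm (c i)) summable_on {i \<in> I. \<mu> i = j}" for j
    by (rule summable_on_subset_banach [OF c]) auto
  have "(\<lambda>p. norm (c (snd p))) summable_on ?fibres"
    using c by (simp add: summable_on_reindex_bij_betw [OF bij, of "\<lambda>i. norm (c i)"])
  then have "(\<lambda>j. \<Sum>\<^sub>\<infinity>i | i \<in> I \<and> \<mu> i = j. norm (c i)) summable_on J"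
    using summable_on_SigmaD [of "\<lambda>p. norm (c (snd p))" J "\<lambda>j. {i \<in> I. \<mu> i = j}"] fibre by simp
  then show "(\<lambda>j. norm (\<Sum>\<^sub>\<infinity>i | i \<in> I \<and> \<mu> i = j. c i)) summable_on J"
    by (rule Infinite_Sum.abs_summable_on_comparison_test') (rule norm_infsum_bound [OF fibre])
  assume "(c has_sum s) I"
  then have "((\<lambda>p. c (snd p)) has_sum s) ?fibres"
    by (simp add: has_sum_reindex_bij_betw [OF bij])
  then show "((\<lambda>j. \<Sum>\<^sub>\<infinity>i | i \<in> I \<and> \<mu> i = j. c i) has_sum s) J"
    by (rule has_sum_SigmaD)
       (simp add: abs_summable_summable [OF fibre] has_sum_infsum)
qed

lemma norm_le_if_has_sum_0_dominated:
  fixes b :: "'i \<Rightarrow> 'a::real_normed_vector"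
  assumes "(b has_sum 0) A" "y \<in> A"
    and "\<And>v. v \<in> A - {y} \<Longrightarrow> norm (b v) \<le> g v" "(g has_sum s) (A - {y})"
  shows "norm (b y) \<le> s"
proof -
  have "(b has_sum 0 - b y) (A - {y})"
    using assms(1) by (rule has_sum_Diff) (use assms(2) in \<open>auto intro: has_sum_finiteI\<close>)
  then have "norm (0 - b y) \<le> s"
    using assms(4,3) by (rule norm_infsum_le)
  then show ?thesis
    by simp
qed

lemma norm_Dirichlet_series_leading_coeff_le:
  fixes a :: "'i \<Rightarrow> 'a::real_normed_vector" and N :: "'i \<Rightarrow> nat"
  assumes a: "(\<lambda>x. norm (a x)) summable_on A" and y: "y \<in> A" "N y > 0"
    and leading: "\<And>x. x \<in> A - {y} \<Longrightarrow> a x \<noteq> 0 \<Longrightarrow> N y < N x"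
    and zero: "((\<lambda>x. a x /\<^sub>R real (N x) ^ m) has_sum 0) A"
  shows "norm (a y) \<le> (real (N y) / real (N y + 1)) ^ m * (\<Sum>\<^sub>\<infinity>x\<in>A - {y}. norm (a x))"
proof -
  define q where "q = real (N y) / real (N y + 1)"
  define b where "b = (\<lambda>x. (real (N y) / real (N x)) ^ m *\<^sub>R a x)"
  have b_sum: "(b has_sum 0) A"
    using has_sum_scaleR [OF zero, of "real (N y) ^ m"]
    by (simp add: b_def divide_inverse power_mult_distrib power_inverse)
  have bound_sum: "((\<lambda>x. q ^ m * norm (a x)) has_sum
      q ^ m * (\<Sum>\<^sub>\<infinity>x\<in>A - {y}. norm (a x))) (A - {y})"
    by (intro has_sum_cmult_right has_sum_infsum summable_on_subset_banach [OF a]) auto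
  have b_le: "norm (b x) \<le> q ^ m * norm (a x)" if x: "x \<in> A - {y}" for x
  proof (cases "a x = 0")
    case False
    then have "N y + 1 \<le> N x"
      using leading [OF x] by simp
    then have "real (N y) / real (N x) \<le> q"
      unfolding q_def by (intro divide_left_mono) auto
    then show ?thesis
      by (simp add: b_def mult_right_mono power_mono)
  qed (simp add: b_def)
  have "norm (b y) \<le> q ^ m * (\<Sum>\<^sub>\<infinity>x\<in>A - {y}. norm (a x))"
    by (rule norm_le_if_has_sum_0_dominated [OF b_sum y(1) b_le bound_sum])
  then show ?thesis
    using y(2) by (simp add: b_def q_def)
qed

lemma Dirichlet_series_coeff_eq_0:
  fixes a :: "'i \<Rightarrow> 'a::real_normed_vector" and N :: "'i \<Rightarrow> nat"
  assumes a: "(\<lambda>x. norm (a x)) summable_on A"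
    and N: "inj_on N A" "\<And>x. x \<in> A \<Longrightarrow> N x > 0"
    and zero: "\<And>m. m > 0 \<Longrightarrow> ((\<lambda>x. a x /\<^sub>R real (N x) ^ m) has_sum 0) A"
    and "x \<in> A"
  shows "a x = 0"
proof (rule ccontr)
  assume "a x \<noteq> 0"
  then obtain y where y: "y \<in> A" "a y \<noteq> 0"
    and least: "\<And>v. v \<in> A \<Longrightarrow> a v \<noteq> 0 \<Longrightarrow> N y \<le> N v"
    using ex_has_least_nat [of "\<lambda>v. v \<in> A \<and> a v \<noteq> 0" x N] \<open>x \<in> A\<close> by blast
  have leading: "N y < N v" if "v \<in> A - {y}" "a v \<noteq> 0" for v
    using that least [of v] N(1) y(1) by (auto simp: order.strict_iff_order dest: inj_onD)
  let ?q = "real (N y) / real (N y + 1)" and ?C = "\<Sum>\<^sub>\<infinity>v\<in>A - {y}. norm (a v)"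
  have "norm (a y) \<le> ?q ^ m * ?C" if "m > 0" for m
    using a y(1) N(2) [OF y(1)] leading zero [OF that]
    by (rule norm_Dirichlet_series_leading_coeff_le)
  moreover have "(\<lambda>m. ?q ^ m * ?C) \<longlonglongrightarrow> 0 * ?C"
    by (intro tendsto_mult_right LIMSEQ_power_zero) simp
  ultimately have "norm (a y) \<le> 0 * ?C"
    by (intro Lim_bounded2 [where N = 1]) auto
  with y(2) show False
    by simp
qed

section \<open>Monomials\<close>

abbreviation on_axis :: "nat \<Rightarrow> 'a::zero \<Rightarrow> nat \<Rightarrow> 'a" where
  "on_axis k t \<equiv> (\<lambda>_. 0)(k := t)"

lemma zero_in_MI [simp]: "(\<lambda>_. 0) \<in> MI"
  by (simp add: MI_def)

lemma MI_fun_upd: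
  assumes "\<alpha> \<in> MI"
  shows "\<alpha>(k := n) \<in> MI"
proof -
  have "finite (insert k {j. \<alpha> j \<noteq> 0})"
    using assms by (simp add: MI_def)
  then show ?thesis
    unfolding MI_def mem_Collect_eq by (rule rev_finite_subset) auto
qed

lemma MI_add:
  assumes "\<alpha> \<in> MI" "\<beta> \<in> MI"
  shows "(\<lambda>j. \<alpha> j + \<beta> j) \<in> MI"
proof -
  have "{j. \<alpha> j + \<beta> j \<noteq> 0} = {j. \<alpha> j \<noteq> 0} \<union> {j. \<beta> j \<noteq> 0}"
    by auto
  then show ?thesis
    using assms by (simp add: MI_def)
qed

lemma MI_comp_bij_iff:
  assumes "bij \<sigma>"
  shows "\<alpha> \<circ> \<sigma> \<in> MI \<longleftrightarrow> \<alpha> \<in> MI"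
proof -
  have "{j. (\<alpha> \<circ> \<sigma>) j \<noteq> 0} = \<sigma> -` {j. \<alpha> j \<noteq> 0}"
    by auto
  then show ?thesis
    unfolding MI_def mem_Collect_eq using finite_vimage_iff [OF assms] by metis
qed

lemma bij_betw_MI_comp:
  assumes "bij \<sigma>"
  shows "bij_betw (\<lambda>\<alpha>. \<alpha> \<circ> \<sigma>) MI MI"
proof (rule bij_betw_byWitness [where f' = "\<lambda>\<alpha>. \<alpha> \<circ> inv \<sigma>"])
  show "\<forall>\<alpha>\<in>MI. \<alpha> \<circ> \<sigma> \<circ> inv \<sigma> = \<alpha>" "\<forall>\<alpha>\<in>MI. \<alpha> \<circ> inv \<sigma> \<circ> \<sigma> = \<alpha>"
    using assms by (simp_all add: fun_eq_iff bij_is_inj bij_is_surj surj_f_inv_f)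
qed (use assms in \<open>auto simp: MI_comp_bij_iff bij_imp_bij_inv\<close>)

lemma monom_zero [simp]: "monom z (\<lambda>_. 0) = 1"
  by (simp add: monom_def)

lemma monom_on_axis [simp]: "monom z (on_axis k n) = z k ^ n"
  by (cases "n = 0") (simp_all add: monom_def)

lemma monom_mult_distrib: "monom (\<lambda>j. x j * y j) \<alpha> = monom x \<alpha> * monom y \<alpha>"
  by (simp add: monom_def power_mult_distrib prod.distrib)

lemma monom_eq_prod_superset:
  assumes "finite S" "{j. \<alpha> j \<noteq> 0} \<subseteq> S"
  shows "monom z \<alpha> = (\<Prod>j\<in>S. z j ^ \<alpha> j)"
  unfolding monom_def by (rule prod.mono_neutral_left) (use assms in auto)

lemma monom_add:
  assumes "\<alpha> \<in> MI" "\<beta> \<in> MI"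
  shows "monom z (\<lambda>j. \<alpha> j + \<beta> j) = monom z \<alpha> * monom z \<beta>"
proof -
  let ?S = "{j. \<alpha> j \<noteq> 0} \<union> {j. \<beta> j \<noteq> 0}"
  have "finite ?S"
    using assms by (simp add: MI_def)
  then show ?thesis
    by (subst (1 2 3) monom_eq_prod_superset [of ?S]) (auto simp: power_add prod.distrib)
qed

lemma monom_comp_bij:
  assumes "bij \<sigma>"
  shows "monom (\<lambda>j. z (\<sigma> j)) (\<alpha> \<circ> \<sigma>) = monom z \<alpha>"
proof -
  have "bij_betw \<sigma> {j. (\<alpha> \<circ> \<sigma>) j \<noteq> 0} {j. \<alpha> j \<noteq> 0}"
    using assms
    by (intro bij_betwI [where g = "inv \<sigma>"]) (auto simp: bij_is_inj bij_is_surj surj_f_inv_f)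
  then show ?thesis
    unfolding monom_def comp_def by (rule prod.reindex_bij_betw)
qed

lemma norm_monom: "norm (monom z \<alpha>) = (\<Prod>j | \<alpha> j \<noteq> 0. norm (z j) ^ \<alpha> j)"
  by (simp add: monom_def norm_power flip: prod_norm)

lemma norm_monom_le_1:
  assumes "z \<in> ballB"
  shows "norm (monom z \<alpha>) \<le> 1"
proof -
  have "norm (z j) \<le> 1" for j
    using assms by (simp add: ballB_def less_imp_le)
  then show ?thesis
    unfolding norm_monom by (intro prod_le_1) (auto intro: power_le_one)
qed

lemma holomorphic_on_monom:
  assumes "\<And>j. (\<lambda>t. z t j) holomorphic_on S"
  shows "(\<lambda>t. monom (z t) \<alpha>) holomorphic_on S"
  unfolding monom_def by (intro holomorphic_intros assms)

section \<open>Uniqueness of the coefficients\<close>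

text \<open>Substituting \<open>z\<^sub>j = p\<^sub>j\<^sup>-\<^sup>m\<close>, with \<open>p\<^sub>j\<close> the \<open>j\<close>-th prime, turns a power series in \<open>z\<close> into a
  Dirichlet series, in which distinct multi-indices keep distinct frequencies by unique
  factorisation.\<close>

definition nth_prime :: "nat \<Rightarrow> nat" where
  "nth_prime = enumerate {p. prime p}"

definition prime_code :: "(nat \<Rightarrow> nat) \<Rightarrow> nat" where
  "prime_code \<alpha> = (\<Prod>j\<in>{j. \<alpha> j \<noteq> 0}. nth_prime j ^ \<alpha> j)"

lemma prime_nth_prime: "prime (nth_prime j)"
  using enumerate_in_set [OF primes_infinite] by (auto simp: nth_prime_def)

lemma strict_mono_nth_prime: "strict_mono nth_prime"
  unfolding nth_prime_def using primes_infinite by (rule strict_mono_enumerate)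

lemma multiplicity_prime_code:
  assumes "\<alpha> \<in> MI"
  shows "multiplicity (nth_prime j) (prime_code \<alpha>) = \<alpha> j"
proof -
  have inj: "inj nth_prime"
    using strict_mono_nth_prime by (rule strict_mono_imp_inj_on)
  let ?S = "{j. \<alpha> j \<noteq> 0}"
  have "prime_code \<alpha> = (\<Prod>q\<in>nth_prime ` ?S. q ^ \<alpha> (the_inv nth_prime q))"
    unfolding prime_code_def
    by (subst prod.reindex) (use inj in \<open>auto simp: the_inv_f_f inj_on_def\<close>)
  also have "multiplicity (nth_prime j) \<dots> =
      (if nth_prime j \<in> nth_prime ` ?S then \<alpha> (the_inv nth_prime (nth_prime j)) else 0)"
    using assms by (intro multiplicity_prod_prime_powers) (auto simp: MI_def prime_nth_prime)
  also have "\<dots> = \<alpha> j"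
    using inj by (simp add: the_inv_f_f inj_image_mem_iff)
  finally show ?thesis .
qed

lemma inj_on_prime_code: "inj_on prime_code MI"
  by (rule inj_onI) (metis multiplicity_prime_code ext)

lemma prime_code_pos: "prime_code \<alpha> > 0"
  unfolding prime_code_def using prime_nth_prime prime_gt_0_nat by (intro prod_pos) auto

lemma monom_inverse_nth_prime:
  "monom (\<lambda>j. inverse (of_nat (nth_prime j) ^ m)) \<alpha> = inverse (of_nat (prime_code \<alpha>) ^ m)"
  by (simp add: monom_def prime_code_def prod_power_distrib
      flip: prod_inversef power_inverse power_mult) (simp add: mult.commute)

lemma inverse_nth_prime_in_ballB:
  assumes "m > 0"
  shows "(\<lambda>j. inverse (of_nat (nth_prime j) ^ m)) \<in> ballB"
proof -
  have "1 < real (nth_prime j) ^ m" for j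
    using prime_gt_1_nat [OF prime_nth_prime, of j] assms by (intro one_less_power) auto
  then have "norm (inverse (of_nat (nth_prime j) ^ m :: complex)) < 1" for j
    by (simp add: norm_inverse norm_power inverse_less_1_iff)
  moreover have "(\<lambda>j. inverse (of_nat (nth_prime j)) :: complex) \<longlonglongrightarrow> 0"
    using LIMSEQ_subseq_LIMSEQ [OF lim_inverse_n strict_mono_nth_prime] by (simp add: o_def)
  then have "(\<lambda>j. inverse (of_nat (nth_prime j)) ^ m :: complex) \<longlonglongrightarrow> 0 ^ m"
    by (rule tendsto_power)
  ultimately show ?thesis
    using assms by (simp add: ballB_def power_inverse power_0_left)
qed

lemma monom_series_coeff_eq_0:
  assumes a: "(\<lambda>\<alpha>. norm (a \<alpha>)) summable_on MI"
    and zero: "\<And>z. z \<in> ballB \<Longrightarrow> ((\<lambda>\<alpha>. a \<alpha> * monom z \<alpha>) has_sum 0) MI"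
    and "\<beta> \<in> MI"
  shows "a \<beta> = 0"
proof (rule Dirichlet_series_coeff_eq_0 [OF a inj_on_prime_code prime_code_pos _ \<open>\<beta> \<in> MI\<close>])
  fix m :: nat assume "m > 0"
  then show "((\<lambda>\<alpha>. a \<alpha> /\<^sub>R real (prime_code \<alpha>) ^ m) has_sum 0) MI"
    using zero [OF inverse_nth_prime_in_ballB]
    by (simp add: monom_inverse_nth_prime scaleR_conv_of_real mult.commute)
qed

section \<open>The algebra of absolutely convergent power series\<close>

lemma abs_summable_mult_monom:
  assumes "(\<lambda>i. norm (c i)) summable_on I" and "z \<in> ballB"
  shows "(\<lambda>i. norm (c i * monom z (\<mu> i))) summable_on I"
  by (rule Infinite_Sum.abs_summable_on_comparison_test' [OF assms(1)])
     (simp add: norm_mult mult_left_le norm_monom_le_1 [OF assms(2)])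

lemma Aplus_rep_iff_has_sum:
  "Aplus_rep a f \<longleftrightarrow>
     (\<forall>\<alpha>. \<alpha> \<notin> MI \<longrightarrow> a \<alpha> = 0) \<and> (\<lambda>\<alpha>. norm (a \<alpha>)) summable_on MI \<and>
     (\<forall>z\<in>ballB. ((\<lambda>\<alpha>. a \<alpha> * monom z \<alpha>) has_sum f z) MI) \<and> (\<forall>z. z \<notin> ballB \<longrightarrow> f z = 0)"
proof (cases "(\<lambda>\<alpha>. norm (a \<alpha>)) summable_on MI")
  case True
  have "(\<lambda>\<alpha>. a \<alpha> * monom z \<alpha>) summable_on MI" if "z \<in> ballB" for z
    by (rule abs_summable_summable [OF abs_summable_mult_monom [OF True that, of "\<lambda>\<alpha>. \<alpha>"]])
  then show ?thesis
    unfolding Aplus_rep_def by (auto simp: has_sum_iff)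
qed (simp add: Aplus_rep_def)

lemma Aplus_rep_add:
  assumes "Aplus_rep a f" "Aplus_rep b g"
  shows "Aplus_rep (\<lambda>\<alpha>. a \<alpha> + b \<alpha>) (\<lambda>z. f z + g z)"
  unfolding Aplus_rep_iff_has_sum
proof (intro conjI)
  have "(\<lambda>\<alpha>. norm (a \<alpha>) + norm (b \<alpha>)) summable_on MI"
    using assms by (auto simp: Aplus_rep_def intro: summable_on_add)
  then show "(\<lambda>\<alpha>. norm (a \<alpha> + b \<alpha>)) summable_on MI"
    by (rule Infinite_Sum.abs_summable_on_comparison_test') (rule norm_triangle_ineq)
qed (use assms in \<open>auto simp: Aplus_rep_iff_has_sum distrib_right intro: has_sum_add\<close>)

lemma Aplus_rep_cmult:
  assumes "Aplus_rep a f"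
  shows "Aplus_rep (\<lambda>\<alpha>. c * a \<alpha>) (\<lambda>z. c * f z)"
  using assms unfolding Aplus_rep_iff_has_sum norm_mult mult.assoc
  by (simp add: has_sum_cmult_right summable_on_cmult_right)

lemma Aplus_rep_unique:
  assumes "Aplus_rep a f" "Aplus_rep b f"
  shows "a = b"
proof
  fix \<alpha>
  have diff: "Aplus_rep (\<lambda>\<alpha>. a \<alpha> + - 1 * b \<alpha>) (\<lambda>z. f z + - 1 * f z)"
    by (intro Aplus_rep_add Aplus_rep_cmult assms)
  show "a \<alpha> = b \<alpha>"
  proof (cases "\<alpha> \<in> MI")
    case True
    with diff have "a \<alpha> + - 1 * b \<alpha> = 0"
      by (intro monom_series_coeff_eq_0 [where a = "\<lambda>\<alpha>. a \<alpha> + - 1 * b \<alpha>"])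
        (auto simp: Aplus_rep_iff_has_sum)
    then show ?thesis
      by simp
  qed (use assms in \<open>simp add: Aplus_rep_def\<close>)
qed

lemma Aplus_norm_eq:
  assumes "Aplus_rep a f"
  shows "Aplus_norm f = (\<Sum>\<^sub>\<infinity>\<alpha>\<in>MI. norm (a \<alpha>))"
proof -
  have "Aplus_rep (SOME a. Aplus_rep a f) f"
    using assms by (rule someI [of "\<lambda>a. Aplus_rep a f"])
  then have "(SOME a. Aplus_rep a f) = a"
    using assms by (rule Aplus_rep_unique)
  then show ?thesis
    by (simp add: Aplus_norm_def)
qed

lemma Aplus_eq_0_outside_ballB: "f \<in> Aplus \<Longrightarrow> z \<notin> ballB \<Longrightarrow> f z = 0"
  by (auto simp: Aplus_def Aplus_rep_def)

lemma Aplus_add: "f \<in> Aplus \<Longrightarrow> g \<in> Aplus \<Longrightarrow> (\<lambda>z. f z + g z) \<in> Aplus"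
  unfolding Aplus_def using Aplus_rep_add by blast

lemma Aplus_cmult: "f \<in> Aplus \<Longrightarrow> (\<lambda>z. c * f z) \<in> Aplus"
  unfolding Aplus_def using Aplus_rep_cmult by blast

text \<open>Since \<open>\<mu>\<close> need not be injective, this also covers products, where \<open>I = MI \<times> MI\<close>.\<close>

lemma monom_series_in_Aplus:
  fixes c :: "'i \<Rightarrow> complex"
  assumes c: "(\<lambda>i. norm (c i)) summable_on I" and \<mu>: "\<mu> ` I \<subseteq> MI"
    and sum: "\<And>z. z \<in> ballB \<Longrightarrow> ((\<lambda>i. c i * monom z (\<mu> i)) has_sum f z) I"
    and outside: "\<And>z. z \<notin> ballB \<Longrightarrow> f z = 0"
  shows "f \<in> Aplus"
proof -
  define a where "a = (\<lambda>\<alpha>. \<Sum>\<^sub>\<infinity>i | i \<in> I \<and> \<mu> i = \<alpha>. c i)"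
  have "a \<alpha> = 0" if "\<alpha> \<notin> MI" for \<alpha>
  proof -
    have "{i. i \<in> I \<and> \<mu> i = \<alpha>} = {}"
      using \<mu> that by auto
    then show ?thesis
      by (simp only: a_def infsum_empty)
  qed
  moreover have "(\<lambda>\<alpha>. norm (a \<alpha>)) summable_on MI"
    unfolding a_def using c \<mu> by (rule abs_summable_infsum_fibres)
  moreover have "((\<lambda>\<alpha>. a \<alpha> * monom z \<alpha>) has_sum f z) MI" if z: "z \<in> ballB" for z
  proof -
    have "a \<alpha> * monom z \<alpha> = (\<Sum>\<^sub>\<infinity>i | i \<in> I \<and> \<mu> i = \<alpha>. c i * monom z (\<mu> i))" for \<alpha>
      unfolding a_def infsum_cmult_left' [symmetric] by (rule infsum_cong) simp
    then show ?thesis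
      using has_sum_infsum_fibres [OF abs_summable_mult_monom [OF c z] \<mu> sum [OF z]]
      by simp
  qed
  ultimately have "Aplus_rep a f"
    using outside by (simp add: Aplus_rep_iff_has_sum)
  then show ?thesis
    by (auto simp: Aplus_def)
qed

lemma Aplus_mult:
  assumes "f \<in> Aplus" "g \<in> Aplus"
  shows "(\<lambda>z. f z * g z) \<in> Aplus"
proof -
  obtain a b where a: "Aplus_rep a f" and b: "Aplus_rep b g"
    using assms by (auto simp: Aplus_def)
  show ?thesis
  proof (rule monom_series_in_Aplus)
    show "(\<lambda>p. norm (a (fst p) * b (snd p))) summable_on MI \<times> MI"
      using a b by (intro abs_summable_mult_Times) (simp_all add: Aplus_rep_def)
    show "(\<lambda>(\<alpha>, \<beta>) j. \<alpha> j + \<beta> j) ` (MI \<times> MI) \<subseteq> MI"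
      by (auto intro: MI_add)
    show "f z * g z = 0" if "z \<notin> ballB" for z
      using assms(1) that by (simp add: Aplus_eq_0_outside_ballB)
    fix z assume z: "z \<in> ballB"
    have "((\<lambda>p. (a (fst p) * monom z (fst p)) * (b (snd p) * monom z (snd p))) has_sum f z * g z)
        (MI \<times> MI)"
      using a b z by (intro has_sum_mult_Times abs_summable_mult_monom)
        (auto simp: Aplus_rep_iff_has_sum)
    also have "?this \<longleftrightarrow> ((\<lambda>p. a (fst p) * b (snd p) * monom z ((\<lambda>(\<alpha>, \<beta>) j. \<alpha> j + \<beta> j) p))
        has_sum f z * g z) (MI \<times> MI)"
      by (intro has_sum_cong) (auto simp: monom_add)
    finally show "((\<lambda>p. a (fst p) * b (snd p) * monom z ((\<lambda>(\<alpha>, \<beta>) j. \<alpha> j + \<beta> j) p))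
        has_sum f z * g z) (MI \<times> MI)" .
  qed
qed

lemma monom_in_Aplus:
  assumes "\<alpha> \<in> MI"
  shows "(\<lambda>z. if z \<in> ballB then monom z \<alpha> else 0) \<in> Aplus"
  by (rule monom_series_in_Aplus [where I = "{\<alpha>}" and c = "\<lambda>_. 1" and \<mu> = id])
     (use assms in \<open>auto intro: has_sum_finiteI\<close>)

lemma Aplus_one_in_Aplus: "Aplus_one \<in> Aplus"
  using monom_in_Aplus [OF zero_in_MI] by (simp add: Aplus_one_def cong: if_cong)

definition coordinate :: "nat \<Rightarrow> seq \<Rightarrow> complex" where
  "coordinate k = (\<lambda>z. if z \<in> ballB then z k else 0)"

lemma coordinate_in_Aplus: "coordinate k \<in> Aplus"
  using monom_in_Aplus [OF MI_fun_upd [OF zero_in_MI, of k 1]]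
  by (simp add: coordinate_def cong: if_cong)

lemma coordinate_resolvent:
  assumes l: "norm l > 1"
  obtains r where "r \<in> Aplus" and "\<And>z. z \<in> ballB \<Longrightarrow> (z k - l) * r z = 1"
proof
  let ?r = "\<lambda>z. if z \<in> ballB then 1 / (z k - l) else 0"
  have geometric: "summable (\<lambda>n. norm (- (1 / l) * w ^ n))" if "norm w < 1" for w :: complex
    unfolding norm_mult norm_power using that by (intro summable_mult summable_geometric) auto
  have inverse_l: "norm (1 / l) < 1"
    using l by (simp add: norm_divide divide_less_eq)
  show "?r \<in> Aplus"
  proof (rule monom_series_in_Aplus)
    show "(\<lambda>n. norm (- (1 / l) * (1 / l) ^ n)) summable_on UNIV"
      using geometric [OF inverse_l] by (intro norm_summable_imp_summable_on) simp
    show "range (on_axis k) \<subseteq> MI"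
      using MI_fun_upd [OF zero_in_MI] by blast
    fix z assume z: "z \<in> ballB"
    then have "norm (z k) < norm l"
      using l by (auto simp: ballB_def intro: less_trans)
    then have "norm (z k / l) < 1" and "z k \<noteq> l" and "l \<noteq> 0"
      by (auto simp: norm_divide divide_less_eq)
    then have "(\<lambda>n. - (1 / l) * (z k / l) ^ n) sums (- (1 / l) * (1 / (1 - z k / l)))"
      by (intro sums_mult geometric_sums)
    also have "- (1 / l) * (1 / (1 - z k / l)) = ?r z"
      using z \<open>z k \<noteq> l\<close> \<open>l \<noteq> 0\<close> by (simp add: divide_simps)
    finally have "((\<lambda>n. - (1 / l) * (z k / l) ^ n) has_sum ?r z) UNIV"
      by (rule norm_summable_imp_has_sum [OF geometric [OF \<open>norm (z k / l) < 1\<close>]])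
    then show "((\<lambda>n. - (1 / l) * (1 / l) ^ n * monom z (on_axis k n)) has_sum ?r z) UNIV"
      by (simp add: power_divide)
  qed simp
  show "(z k - l) * ?r z = 1" if "z \<in> ballB" for z
    using that l by (auto simp: ballB_def dest: spec [of _ k])
qed

lemma holomorphic_on_has_sum:
  assumes S: "open S" and hol: "\<And>i. i \<in> I \<Longrightarrow> f i holomorphic_on S"
    and sum: "\<And>t. t \<in> S \<Longrightarrow> ((\<lambda>i. f i t) has_sum g t) I"
    and M: "\<And>i t. i \<in> I \<Longrightarrow> t \<in> S \<Longrightarrow> norm (f i t) \<le> M i" "M summable_on I"
  shows "g holomorphic_on S"
proof -
  define partial where "partial = (\<lambda>F t. \<Sum>i\<in>F. f i t)"
  have limit: "uniform_limit S partial g (finite_subsets_at_top I)"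
    unfolding partial_def using M(1) sum M(2) by (rule Weierstrass_m_test_general')
  have "\<exists>r>0. g holomorphic_on ball t r" if t: "t \<in> S" for t
  proof -
    obtain r where r: "r > 0" "cball t r \<subseteq> S"
      using S t unfolding open_contains_cball by blast
    have "partial F holomorphic_on cball t r" if "F \<subseteq> I" for F
      unfolding partial_def
      by (intro holomorphic_intros holomorphic_on_subset [OF hol r(2)]) (use that in auto)
    then have "\<forall>\<^sub>F F in finite_subsets_at_top I.
        continuous_on (cball t r) (partial F) \<and> partial F holomorphic_on ball t r"
      by (intro eventually_finite_subsets_at_top_weakI conjI)
        (auto intro: holomorphic_on_imp_continuous_on
          holomorphic_on_subset [OF _ ball_subset_cball])
    then have "g holomorphic_on ball t r"
      by (rule holomorphic_uniform_limit [OF _ uniform_limit_on_subset [OF limit r(2)]]) auto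
    with r(1) show ?thesis
      by blast
  qed
  then show ?thesis
    unfolding analytic_on_open [OF S, symmetric] analytic_on_def by blast
qed

lemma holomorphic_on_Aplus_comp:
  assumes "f \<in> Aplus" and S: "open S"
    and hol: "\<And>j. (\<lambda>t. z t j) holomorphic_on S" and z: "\<And>t. t \<in> S \<Longrightarrow> z t \<in> ballB"
  shows "(\<lambda>t. f (z t)) holomorphic_on S"
proof -
  obtain a where a: "Aplus_rep a f"
    using \<open>f \<in> Aplus\<close> by (auto simp: Aplus_def)
  show ?thesis
  proof (rule holomorphic_on_has_sum [OF S])
    show "(\<lambda>t. a \<alpha> * monom (z t) \<alpha>) holomorphic_on S" for \<alpha>
      by (intro holomorphic_intros holomorphic_on_monom hol)
    show "((\<lambda>\<alpha>. a \<alpha> * monom (z t) \<alpha>) has_sum f (z t)) MI" if "t \<in> S" for t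
      using a z [OF that] by (simp add: Aplus_rep_iff_has_sum)
    show "(\<lambda>\<alpha>. norm (a \<alpha>)) summable_on MI"
      using a by (simp add: Aplus_rep_def)
    show "norm (a \<alpha> * monom (z t) \<alpha>) \<le> norm (a \<alpha>)" if "t \<in> S" for \<alpha> t
      using norm_monom_le_1 [OF z [OF that]] by (simp add: norm_mult mult_left_le)
  qed
qed

section \<open>Automorphisms\<close>

lemma Aplus_automorphism_comp_opI:
  assumes \<phi>: "\<And>z. z \<in> ballB \<Longrightarrow> \<phi> z \<in> ballB" and \<psi>: "\<And>z. z \<in> ballB \<Longrightarrow> \<psi> z \<in> ballB"
    and inverse: "\<And>z. z \<in> ballB \<Longrightarrow> \<psi> (\<phi> z) = z" "\<And>z. z \<in> ballB \<Longrightarrow> \<phi> (\<psi> z) = z"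
    and Aplus: "\<And>f. f \<in> Aplus \<Longrightarrow> comp_op \<phi> f \<in> Aplus" "\<And>f. f \<in> Aplus \<Longrightarrow> comp_op \<psi> f \<in> Aplus"
  shows "Aplus_automorphism (comp_op \<phi>)"
proof -
  have "bij_betw (comp_op \<phi>) Aplus Aplus"
    by (rule bij_betw_byWitness [where f' = "comp_op \<psi>"])
       (use assms in \<open>auto simp: comp_op_def Aplus_eq_0_outside_ballB intro!: ext\<close>)
  then show ?thesis
    using \<phi> by (auto simp: Aplus_automorphism_def comp_op_def Aplus_one_def fun_eq_iff)
qed

lemma Aplus_automorphism_reflects_inverse:
  assumes T: "Aplus_automorphism T" and "f \<in> Aplus" "g \<in> Aplus"
    and inverse: "(\<lambda>z. T f z * g z) = Aplus_one"
  obtains h where "h \<in> Aplus" "(\<lambda>z. f z * h z) = Aplus_one"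
proof -
  have bij: "bij_betw T Aplus Aplus"
    using T by (simp add: Aplus_automorphism_def)
  then obtain h where h: "h \<in> Aplus" "T h = g"
    using \<open>g \<in> Aplus\<close> by (metis bij_betw_imp_surj_on imageE)
  have "T (\<lambda>z. f z * h z) = T Aplus_one"
    using T \<open>f \<in> Aplus\<close> h inverse by (simp add: Aplus_automorphism_def)
  then have "(\<lambda>z. f z * h z) = Aplus_one"
    using bij_betw_imp_inj_on [OF bij] Aplus_mult [OF \<open>f \<in> Aplus\<close> h(1)] Aplus_one_in_Aplus
    by (auto dest: inj_onD)
  with h(1) show ?thesis
    by (rule that)
qed

lemma norm_automorphism_preimage_coordinate_le_1:
  assumes T: "Aplus_automorphism T" and f: "f \<in> Aplus" "T f = coordinate k" and w: "w \<in> ballB"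
  shows "norm (f w) \<le> 1"
proof (rule ccontr)
  assume "\<not> norm (f w) \<le> 1"
  define l where "l = f w"
  have "norm l > 1"
    using \<open>\<not> norm (f w) \<le> 1\<close> by (simp add: l_def)
  then obtain r where r: "r \<in> Aplus" "\<And>z. z \<in> ballB \<Longrightarrow> (z k - l) * r z = 1"
    using coordinate_resolvent by metis
  define c where "c = (\<lambda>z. - l * Aplus_one z)"
  define g where "g = (\<lambda>z. f z + c z)"
  have c: "c \<in> Aplus"
    unfolding c_def by (intro Aplus_cmult Aplus_one_in_Aplus)
  have g: "g \<in> Aplus"
    unfolding g_def by (intro Aplus_add f c)
  have "T c = c"
    using T Aplus_one_in_Aplus unfolding Aplus_automorphism_def c_def by metis
  then have "T g = (\<lambda>z. coordinate k z + c z)"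
    using T f c by (simp add: Aplus_automorphism_def g_def)
  then have "(\<lambda>z. T g z * r z) = Aplus_one"
    using r by (auto simp: coordinate_def c_def Aplus_one_def fun_eq_iff)
  then obtain h where h: "(\<lambda>z. g z * h z) = Aplus_one"
    using Aplus_automorphism_reflects_inverse [OF T g r(1)] by blast
  have "g w = 0"
    using w by (simp add: g_def c_def l_def Aplus_one_def)
  then show False
    using fun_cong [OF h, of w] w by (simp add: Aplus_one_def)
qed

section \<open>Weighted permutations of the coordinates\<close>

definition weighted_perm :: "(nat \<Rightarrow> nat) \<Rightarrow> seq \<Rightarrow> seq \<Rightarrow> seq" where
  "weighted_perm \<sigma> \<epsilon> z = (\<lambda>j. \<epsilon> j * z (\<sigma> j))"

lemma weighted_perm_in_ballB:
  assumes \<sigma>: "bij \<sigma>" and \<epsilon>: "\<And>j. norm (\<epsilon> j) = 1" and z: "z \<in> ballB"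
  shows "weighted_perm \<sigma> \<epsilon> z \<in> ballB"
proof -
  have "filterlim \<sigma> sequentially sequentially"
    unfolding filterlim_iff cofinite_eq_sequentially [symmetric]
    using MOST_inj [OF _ bij_is_inj [OF \<sigma>]] by blast
  then have "(\<lambda>j. z (\<sigma> j)) \<longlonglongrightarrow> 0"
    using z by (auto simp: ballB_def intro: filterlim_compose)
  then have "(\<lambda>j. norm (\<epsilon> j * z (\<sigma> j))) \<longlonglongrightarrow> 0"
    by (simp add: norm_mult \<epsilon> tendsto_norm_zero)
  then have "(\<lambda>j. \<epsilon> j * z (\<sigma> j)) \<longlonglongrightarrow> 0"
    by (rule tendsto_norm_zero_cancel)
  then show ?thesis
    using z \<epsilon> by (auto simp: weighted_perm_def ballB_def norm_mult)
qed

lemma monom_weighted_perm: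
  assumes "bij \<sigma>"
  shows "monom (weighted_perm \<sigma> \<epsilon> z) (\<alpha> \<circ> \<sigma>) = monom \<epsilon> (\<alpha> \<circ> \<sigma>) * monom z \<alpha>"
  by (simp add: weighted_perm_def monom_mult_distrib monom_comp_bij [OF assms])

lemma Aplus_rep_comp_weighted_perm:
  assumes \<sigma>: "bij \<sigma>" and \<epsilon>: "\<And>j. norm (\<epsilon> j) = 1" and a: "Aplus_rep a f"
  shows "Aplus_rep (\<lambda>\<alpha>. a (\<alpha> \<circ> \<sigma>) * monom \<epsilon> (\<alpha> \<circ> \<sigma>)) (comp_op (weighted_perm \<sigma> \<epsilon>) f)"
  unfolding Aplus_rep_iff_has_sum
proof (intro conjI allI impI ballI)
  show "a (\<alpha> \<circ> \<sigma>) * monom \<epsilon> (\<alpha> \<circ> \<sigma>) = 0" if "\<alpha> \<notin> MI" for \<alpha>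
    using a that by (simp add: Aplus_rep_def MI_comp_bij_iff [OF \<sigma>])
  show "(\<lambda>\<alpha>. norm (a (\<alpha> \<circ> \<sigma>) * monom \<epsilon> (\<alpha> \<circ> \<sigma>))) summable_on MI"
    using a summable_on_reindex_bij_betw [OF bij_betw_MI_comp [OF \<sigma>], of "\<lambda>\<alpha>. norm (a \<alpha>)"]
    by (simp add: Aplus_rep_def norm_mult norm_monom \<epsilon>)
  fix z assume z: "z \<in> ballB"
  have "((\<lambda>\<alpha>. a \<alpha> * monom (weighted_perm \<sigma> \<epsilon> z) \<alpha>) has_sum f (weighted_perm \<sigma> \<epsilon> z)) MI"
    using a weighted_perm_in_ballB [OF \<sigma> \<epsilon> z] by (simp add: Aplus_rep_iff_has_sum)
  then have "((\<lambda>\<alpha>. a (\<alpha> \<circ> \<sigma>) * monom (weighted_perm \<sigma> \<epsilon> z) (\<alpha> \<circ> \<sigma>)) has_sum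
      f (weighted_perm \<sigma> \<epsilon> z)) MI"
    by (simp add: has_sum_reindex_bij_betw [OF bij_betw_MI_comp [OF \<sigma>],
          of "\<lambda>\<alpha>. a \<alpha> * monom (weighted_perm \<sigma> \<epsilon> z) \<alpha>"])
  then show "((\<lambda>\<alpha>. a (\<alpha> \<circ> \<sigma>) * monom \<epsilon> (\<alpha> \<circ> \<sigma>) * monom z \<alpha>) has_sum
      comp_op (weighted_perm \<sigma> \<epsilon>) f z) MI"
    using z by (simp add: comp_op_def monom_weighted_perm [OF \<sigma>] mult.assoc)
qed (simp add: comp_op_def)

lemma comp_weighted_perm_in_Aplus:
  assumes "bij \<sigma>" "\<And>j. norm (\<epsilon> j) = 1" "f \<in> Aplus"
  shows "comp_op (weighted_perm \<sigma> \<epsilon>) f \<in> Aplus"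
  using Aplus_rep_comp_weighted_perm assms unfolding Aplus_def mem_Collect_eq by metis

lemma Aplus_norm_comp_weighted_perm:
  assumes \<sigma>: "bij \<sigma>" and \<epsilon>: "\<And>j. norm (\<epsilon> j) = 1" and "f \<in> Aplus"
  shows "Aplus_norm (comp_op (weighted_perm \<sigma> \<epsilon>) f) = Aplus_norm f"
proof -
  obtain a where a: "Aplus_rep a f"
    using \<open>f \<in> Aplus\<close> by (auto simp: Aplus_def)
  have "Aplus_norm (comp_op (weighted_perm \<sigma> \<epsilon>) f) = (\<Sum>\<^sub>\<infinity>\<alpha>\<in>MI. norm (a (\<alpha> \<circ> \<sigma>)))"
    by (simp add: Aplus_norm_eq [OF Aplus_rep_comp_weighted_perm [OF \<sigma> \<epsilon> a]]
        norm_mult norm_monom \<epsilon>)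
  also have "\<dots> = (\<Sum>\<^sub>\<infinity>\<alpha>\<in>MI. norm (a \<alpha>))"
    by (rule infsum_reindex_bij_betw [OF bij_betw_MI_comp [OF \<sigma>]])
  finally show ?thesis
    by (simp add: Aplus_norm_eq [OF a])
qed

lemma Aplus_automorphism_comp_weighted_perm:
  assumes \<sigma>: "bij \<sigma>" and \<epsilon>: "\<And>j. norm (\<epsilon> j) = 1"
  shows "Aplus_automorphism (comp_op (weighted_perm \<sigma> \<epsilon>))"
proof (rule Aplus_automorphism_comp_opI)
  let ?\<psi> = "weighted_perm (inv \<sigma>) (\<lambda>j. inverse (\<epsilon> (inv \<sigma> j)))"
  have \<epsilon>': "norm (inverse (\<epsilon> (inv \<sigma> j))) = 1" for j
    by (simp add: norm_inverse \<epsilon>)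
  have nonzero: "\<epsilon> j \<noteq> 0" for j
    using \<epsilon> [of j] by auto
  note \<sigma>' = bij_imp_bij_inv [OF \<sigma>]
  show "comp_op (weighted_perm \<sigma> \<epsilon>) f \<in> Aplus" "comp_op ?\<psi> f \<in> Aplus" if "f \<in> Aplus" for f
    using comp_weighted_perm_in_Aplus [OF \<sigma> \<epsilon> that] comp_weighted_perm_in_Aplus [OF \<sigma>' \<epsilon>' that] .
  show "weighted_perm \<sigma> \<epsilon> z \<in> ballB" "?\<psi> z \<in> ballB" if "z \<in> ballB" for z
    using weighted_perm_in_ballB [OF \<sigma> \<epsilon> that] weighted_perm_in_ballB [OF \<sigma>' \<epsilon>' that] .
  show "?\<psi> (weighted_perm \<sigma> \<epsilon> z) = z" "weighted_perm \<sigma> \<epsilon> (?\<psi> z) = z" for z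
    using \<sigma> by (simp_all add: weighted_perm_def nonzero bij_is_surj bij_is_inj surj_f_inv_f
        flip: mult.assoc)
qed

section \<open>The unit ball of \<open>c\<^sub>0\<close>\<close>

lemma LIMSEQ_fun_upd:
  assumes "x \<longlonglongrightarrow> l"
  shows "x(k := c) \<longlonglongrightarrow> l"
proof -
  have "\<forall>\<^sub>F j in sequentially. (x(k := c)) j = x j"
    using eventually_gt_at_top [of k] by eventually_elim simp
  then show ?thesis
    using assms by (simp add: tendsto_cong)
qed

lemma fun_upd_in_ballB: "z \<in> ballB \<Longrightarrow> norm w < 1 \<Longrightarrow> z(k := w) \<in> ballB"
  by (simp add: ballB_def LIMSEQ_fun_upd)

lemma zero_in_ballB [simp]: "(\<lambda>_. 0) \<in> ballB"
  by (simp add: ballB_def)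

lemma on_axis_in_ballB: "norm t < 1 \<Longrightarrow> on_axis k t \<in> ballB"
  by (rule fun_upd_in_ballB [OF zero_in_ballB])

lemma on_axis_in_c0: "on_axis k t \<in> c0"
  by (simp add: c0_def LIMSEQ_fun_upd)

lemma convex_combination_in_ballB:
  assumes x: "x \<in> ballB" and y: "y \<in> ballB" and ab: "0 \<le> a" "0 \<le> b" "a + b = 1"
  shows "(\<lambda>j. a *\<^sub>R x j + b *\<^sub>R y j) \<in> ballB"
proof -
  have "a *\<^sub>R x j + b *\<^sub>R y j \<in> ball 0 1" for j
    using x y ab by (intro convexD [OF convex_ball]) (auto simp: ballB_def)
  moreover have "(\<lambda>j. a *\<^sub>R x j + b *\<^sub>R y j) \<longlonglongrightarrow> a *\<^sub>R 0 + b *\<^sub>R 0"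
    using x y by (intro tendsto_intros) (auto simp: ballB_def)
  ultimately show ?thesis
    by (simp add: ballB_def)
qed

lemma ballB_uniform_bound:
  assumes "z \<in> ballB"
  obtains r where "r < 1" "\<And>j. norm (z j) \<le> r"
proof -
  have "compact (insert 0 (range z))"
    using assms by (intro compact_sequence_with_limit) (simp add: ballB_def)
  then obtain c where c: "c \<in> insert 0 (range z)" "\<And>y. y \<in> insert 0 (range z) \<Longrightarrow> norm y \<le> norm c"
    using continuous_attains_sup [OF _ insert_not_empty continuous_on_norm_id] by meson
  show ?thesis
  proof
    show "norm c < 1"
      using assms c(1) by (auto simp: ballB_def)
    show "norm (z j) \<le> norm c" for j
      using c(2) by simp
  qed
qed

lemma norm_le_supnorm:
  assumes "y \<in> c0"
  shows "norm (y j) \<le> supnorm y"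
proof -
  have "Bseq y"
    using assms by (auto simp: c0_def intro!: convergent_imp_Bseq convergentI)
  then have "bdd_above (range (\<lambda>j. norm (y j)))"
    by (auto simp: Bseq_def bdd_above_def)
  then show ?thesis
    unfolding supnorm_def by (intro cSUP_upper) auto
qed

lemma supnorm_nonneg: "y \<in> c0 \<Longrightarrow> 0 \<le> supnorm y"
  using norm_le_supnorm [of y 0] by (rule order_trans [OF norm_ge_zero])

lemma supnorm_scale_le:
  assumes "y \<in> c0"
  shows "supnorm (\<lambda>j. c * y j) \<le> norm c * supnorm y"
  using norm_le_supnorm [OF assms]
  unfolding supnorm_def [of "\<lambda>j. c * y j"] norm_mult
  by (intro cSUP_least mult_left_mono) auto

lemma c0_scale: "y \<in> c0 \<Longrightarrow> (\<lambda>j. c * y j) \<in> c0"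
  by (simp add: c0_def tendsto_mult_right_zero)

lemma open_line_in_ballB:
  assumes y: "y \<in> c0"
  shows "open {t. (\<lambda>j. x j + t * y j) \<in> ballB}"
  unfolding open_dist
proof
  fix t assume "t \<in> {t. (\<lambda>j. x j + t * y j) \<in> ballB}"
  then have t: "(\<lambda>j. x j + t * y j) \<in> ballB"
    by simp
  then obtain r where r: "r < 1" "\<And>j. norm (x j + t * y j) \<le> r"
    using ballB_uniform_bound by blast
  define \<delta> where "\<delta> = (1 - r) / (supnorm y + 1)"
  have "\<delta> > 0"
    using r(1) supnorm_nonneg [OF y] by (simp add: \<delta>_def)
  moreover have "(\<lambda>j. x j + s * y j) \<in> ballB" if s: "dist s t < \<delta>" for s
  proof -
    have decompose: "x j + s * y j = (x j + t * y j) + (s - t) * y j" for j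
      by (simp add: algebra_simps)
    have "norm (x j + s * y j) < 1" for j
    proof -
      have "norm (x j + s * y j) \<le> r + norm (s - t) * (supnorm y + 1)"
        unfolding decompose using norm_le_supnorm [OF y, of j]
        by (intro norm_triangle_le add_mono r(2)) (simp add: norm_mult mult_left_mono)
      also have "\<dots> < r + \<delta> * (supnorm y + 1)"
        using s supnorm_nonneg [OF y] by (simp add: dist_norm)
      also have "\<dots> = 1"
        using supnorm_nonneg [OF y] by (simp add: \<delta>_def)
      finally show ?thesis .
    qed
    moreover have "(\<lambda>j. (x j + t * y j) + (s - t) * y j) \<longlonglongrightarrow> 0 + 0"
      using t c0_scale [OF y, of "s - t"] by (intro tendsto_add) (auto simp: ballB_def c0_def)
    ultimately show ?thesis
      by (simp add: ballB_def decompose [symmetric])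
  qed
  ultimately show "\<exists>\<delta>>0. \<forall>s. dist s t < \<delta> \<longrightarrow> s \<in> {t. (\<lambda>j. x j + t * y j) \<in> ballB}"
    by blast
qed

lemma convex_line_in_ballB: "convex {t. (\<lambda>j. x j + t * y j) \<in> ballB}"
proof (rule convexI)
  fix s t :: complex and a b :: real
  assume "s \<in> {t. (\<lambda>j. x j + t * y j) \<in> ballB}" "t \<in> {t. (\<lambda>j. x j + t * y j) \<in> ballB}"
    and ab: "0 \<le> a" "0 \<le> b" "a + b = 1"
  then have "(\<lambda>j. a *\<^sub>R (x j + s * y j) + b *\<^sub>R (x j + t * y j)) \<in> ballB"
    by (intro convex_combination_in_ballB) auto
  also have "(\<lambda>j. a *\<^sub>R (x j + s * y j) + b *\<^sub>R (x j + t * y j)) =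
      (\<lambda>j. (a + b) *\<^sub>R x j + (a *\<^sub>R s + b *\<^sub>R t) * y j)"
    by (simp add: algebra_simps)
  finally show "a *\<^sub>R s + b *\<^sub>R t \<in> {t. (\<lambda>j. x j + t * y j) \<in> ballB}"
    by (simp add: ab(3))
qed

section \<open>Analytic functions on the unit ball of \<open>c\<^sub>0\<close>\<close>

lemma bounded_clinear_functional_c0_scale:
  assumes "bounded_clinear_functional_c0 L" "y \<in> c0"
  shows "L (\<lambda>j. c * y j) = c * L y"
proof -
  have "L (\<lambda>j. c * y j + 0 * y j) = c * L y + 0 * L y"
    using assms unfolding bounded_clinear_functional_c0_def by blast
  then show ?thesis
    by simp
qed

lemma supnorm_little_o_on_line:
  fixes r :: "seq \<Rightarrow> complex"
  assumes y: "y \<in> c0" and e: "e > 0"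
    and r: "\<And>e. e > 0 \<Longrightarrow> \<exists>d>0. \<forall>h\<in>c0. supnorm h < d \<longrightarrow> norm (r h) \<le> e * supnorm h"
  shows "\<exists>d>0. \<forall>c. norm c < d \<longrightarrow> norm (r (\<lambda>j. c * y j)) \<le> e * norm c"
proof -
  define M where "M = supnorm y + 1"
  have M: "M > 0"
    using supnorm_nonneg [OF y] by (simp add: M_def)
  have supnorm_le: "supnorm (\<lambda>j. c * y j) \<le> norm c * M" for c
    using supnorm_scale_le [OF y, of c] by (rule order_trans) (simp add: M_def mult_left_mono)
  obtain d where d: "d > 0"
    and r_le: "\<And>h. h \<in> c0 \<Longrightarrow> supnorm h < d \<Longrightarrow> norm (r h) \<le> e / M * supnorm h"
    using r [of "e / M"] e M by auto
  have "norm (r (\<lambda>j. c * y j)) \<le> e * norm c" if c: "norm c < d / M" for c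
  proof -
    have "supnorm (\<lambda>j. c * y j) < d"
      using supnorm_le [of c] c M by (simp add: field_simps)
    then have "norm (r (\<lambda>j. c * y j)) \<le> e / M * supnorm (\<lambda>j. c * y j)"
      by (intro r_le c0_scale y)
    also have "\<dots> \<le> e / M * (norm c * M)"
      using e M by (intro mult_left_mono supnorm_le) auto
    finally show ?thesis
      using M by simp
  qed
  then show ?thesis
    using d M by (intro exI [of _ "d / M"]) auto
qed

lemma analytic_fun_B_differentiable_on_line:
  assumes u: "analytic_fun_B u" and y: "y \<in> c0" and t: "(\<lambda>j. x j + t * y j) \<in> ballB"
  shows "(\<lambda>t. u (\<lambda>j. x j + t * y j)) field_differentiable at t"
proof -
  let ?g = "\<lambda>t. u (\<lambda>j. x j + t * y j)"
  obtain L where L: "bounded_clinear_functional_c0 L"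
    and L_approx: "\<And>e. e > 0 \<Longrightarrow> \<exists>d>0. \<forall>h\<in>c0. supnorm h < d \<longrightarrow>
      norm (u (\<lambda>j. (x j + t * y j) + h j) - ?g t - L h) \<le> e * supnorm h"
    using bspec [OF u [unfolded analytic_fun_B_def] t] by auto
  have shift: "(\<lambda>j. (x j + t * y j) + (s - t) * y j) = (\<lambda>j. x j + s * y j)" for s
    by (simp add: algebra_simps)
  have "(?g has_field_derivative L y) (at t)"
    unfolding has_field_derivative_def has_derivative_at_alt
  proof (intro conjI allI impI bounded_linear_mult_right)
    fix e :: real assume "e > 0"
    then obtain d where "d > 0" and d: "\<And>c. norm c < d \<Longrightarrow>
        norm (u (\<lambda>j. (x j + t * y j) + c * y j) - ?g t - L (\<lambda>j. c * y j)) \<le> e * norm c"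
      using supnorm_little_o_on_line [OF y _ L_approx] by blast
    have "norm (?g s - ?g t - L y * (s - t)) \<le> e * norm (s - t)" if "norm (s - t) < d" for s
      using d [OF that]
      by (simp only: shift bounded_clinear_functional_c0_scale [OF L y] mult.commute [of "L y"])
    with \<open>d > 0\<close> show "\<exists>d>0. \<forall>s. norm (s - t) < d \<longrightarrow>
        norm (?g s - ?g t - L y * (s - t)) \<le> e * norm (s - t)"
      by blast
  qed
  then show ?thesis
    by (auto simp: field_differentiable_def)
qed

lemma analytic_fun_B_holomorphic_on_line:
  assumes "analytic_fun_B u" "y \<in> c0"
  shows "(\<lambda>t. u (\<lambda>j. x j + t * y j)) holomorphic_on {t. (\<lambda>j. x j + t * y j) \<in> ballB}"
  unfolding holomorphic_on_open [OF open_line_in_ballB [OF assms(2)]]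
    field_differentiable_def [symmetric]
proof
  fix t assume "t \<in> {t. (\<lambda>j. x j + t * y j) \<in> ballB}"
  then show "(\<lambda>t. u (\<lambda>j. x j + t * y j)) field_differentiable at t"
    by (intro analytic_fun_B_differentiable_on_line assms) simp
qed

lemma analytic_fun_B_holomorphic_on_slice:
  assumes u: "analytic_fun_B u" and z: "z \<in> ballB"
  shows "(\<lambda>w. u (z(k := w))) holomorphic_on ball 0 1"
proof -
  have slice: "z(k := w) = (\<lambda>j. (z(k := 0)) j + w * on_axis k 1 j)" for w
    by (simp add: fun_eq_iff)
  have "(\<lambda>w. u (z(k := w))) holomorphic_on {w. z(k := w) \<in> ballB}"
    using analytic_fun_B_holomorphic_on_line [OF u on_axis_in_c0, of "z(k := 0)" k 1]
    by (simp only: slice [symmetric])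
  moreover have "ball 0 1 \<subseteq> {w. z(k := w) \<in> ballB}"
    using fun_upd_in_ballB [OF z] by auto
  ultimately show ?thesis
    by (rule holomorphic_on_subset)
qed

lemma analytic_fun_B_maximum_modulus_principle:
  assumes u: "analytic_fun_B u" and x: "x \<in> ballB" and z: "z \<in> ballB"
    and max: "\<And>y. y \<in> ballB \<Longrightarrow> norm (u y) \<le> norm (u x)"
  shows "u z = u x"
proof -
  let ?line = "\<lambda>t j. x j + t * (z j - x j)"
  let ?S = "{t. ?line t \<in> ballB}"
  have "(\<lambda>j. z j - x j) \<longlonglongrightarrow> 0 - 0"
    using x z by (intro tendsto_diff) (simp_all add: ballB_def)
  then have c0: "(\<lambda>j. z j - x j) \<in> c0"
    by (simp add: c0_def)
  have ends: "0 \<in> ?S" "1 \<in> ?S"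
    using x z by simp_all
  have "(\<lambda>t. u (?line t)) constant_on ?S"
  proof (rule maximum_modulus_principle [where U = ?S and \<xi> = 0])
    show "(\<lambda>t. u (?line t)) holomorphic_on ?S"
      using u c0 by (rule analytic_fun_B_holomorphic_on_line)
    show "connected ?S"
      by (rule convex_connected [OF convex_line_in_ballB])
    show "norm (u (?line t)) \<le> norm (u (?line 0))" if "t \<in> ?S" for t
      using max [of "?line t"] that by simp
    show "open ?S" "open ?S"
      by (rule open_line_in_ballB [OF c0])+
  qed (rule order_refl ends(1))+
  then obtain c where c: "\<And>t. t \<in> ?S \<Longrightarrow> u (?line t) = c"
    unfolding constant_on_def by blast
  show ?thesis
    using c [OF ends(1)] c [OF ends(2)] by simp
qed

section \<open>Consequences of the Schwarz lemma\<close>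

lemma norm_le_if_norm_power_mult_le:
  fixes g :: "complex \<Rightarrow> complex"
  assumes g: "g holomorphic_on ball 0 1"
    and le: "\<And>w. norm w < 1 \<Longrightarrow> norm (w ^ d * g w) \<le> B" and w: "norm w < 1"
  shows "norm (g w) \<le> B"
proof -
  have bound: "\<rho> ^ d * norm (g w) \<le> B" if \<rho>: "norm w < \<rho>" "\<rho> < 1" for \<rho>
  proof -
    have "\<rho> > 0"
      using \<rho> norm_ge_zero [of w] by linarith
    have "norm (g w) \<le> B / \<rho> ^ d"
    proof (rule maximum_modulus_frontier [where f = g and S = "cball 0 \<rho>"])
      show "g holomorphic_on interior (cball 0 \<rho>)"
        using \<rho> by (intro holomorphic_on_subset [OF g]) auto
      show "continuous_on (closure (cball 0 \<rho>)) g"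
        using \<rho> by (intro holomorphic_on_imp_continuous_on holomorphic_on_subset [OF g]) auto
      fix v :: complex assume "v \<in> frontier (cball 0 \<rho>)"
      then have "norm v = \<rho>"
        using \<open>\<rho> > 0\<close> by (simp add: frontier_cball)
      then show "norm (g v) \<le> B / \<rho> ^ d"
        using le [of v] \<rho> \<open>\<rho> > 0\<close> by (simp add: norm_mult norm_power field_simps)
    qed (use \<rho> in auto)
    then show ?thesis
      using \<open>\<rho> > 0\<close> by (simp add: field_simps)
  qed
  have "((\<lambda>\<rho>. \<rho> ^ d * norm (g w)) \<longlongrightarrow> 1 ^ d * norm (g w)) (at_left 1)"
    by (intro tendsto_intros)
  moreover have "\<forall>\<^sub>F \<rho> in at_left 1. \<rho> ^ d * norm (g w) \<le> B"
    using bound w by (intro eventually_at_leftI [of "norm w"]) auto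
  ultimately show ?thesis
    using tendsto_upperbound by fastforce
qed

lemma Schwarz_Lemma_le:
  assumes h: "h holomorphic_on ball 0 1" "h 0 = 0"
    and le: "\<And>w. norm w < 1 \<Longrightarrow> norm (h w) \<le> B" and w: "norm w < 1"
  shows "norm (h w) \<le> B * norm w"
proof -
  obtain g where g: "g holomorphic_on ball 0 1" "\<And>z. norm z < 1 \<Longrightarrow> h z = z * g z"
    by (rule Schwarz3 [OF h]) (rule that)
  have g_le: "norm (g w) \<le> B"
    by (rule norm_le_if_norm_power_mult_le [OF g(1) _ w, where d = 1]) (use le g(2) in simp)
  show ?thesis
    using mult_left_mono [OF g_le norm_ge_zero [of w]] g(2) [OF w]
    by (simp add: norm_mult mult.commute)
qed

lemma norm_analytic_fun_B_le_if_norm_power_mult_le: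
  assumes u: "analytic_fun_B u"
    and le: "\<And>z. z \<in> ballB \<Longrightarrow> norm (z k ^ d * u z) \<le> B" and z: "z \<in> ballB"
  shows "norm (u z) \<le> B"
proof -
  have "norm (u (z(k := z k))) \<le> B"
  proof (rule norm_le_if_norm_power_mult_le [where g = "\<lambda>w. u (z(k := w))"])
    show "(\<lambda>w. u (z(k := w))) holomorphic_on ball 0 1"
      using u z by (rule analytic_fun_B_holomorphic_on_slice)
    show "norm (w ^ d * u (z(k := w))) \<le> B" if "norm w < 1" for w
      using le [OF fun_upd_in_ballB [OF z that, of k]] by simp
    show "norm (z k) < 1"
      using z by (simp add: ballB_def)
  qed
  then show ?thesis
    by simp
qed

section \<open>Automorphisms preserving the coordinate hyperplanes\<close>

lemma automorphism_norm_le_on_axis: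
  assumes aut: "Aplus_automorphism (comp_op \<phi>)"
    and axis: "\<And>t. norm t < 1 \<Longrightarrow> \<phi> (on_axis k t) = on_axis k (p t)"
    and p: "\<And>t. norm t < 1 \<Longrightarrow> norm (p t) < 1" "p 0 = 0" and t: "norm t < 1"
  shows "norm t \<le> norm (p t)"
proof -
  have "bij_betw (comp_op \<phi>) Aplus Aplus"
    using aut by (simp add: Aplus_automorphism_def)
  then obtain f where f: "f \<in> Aplus" "comp_op \<phi> f = coordinate k"
    using coordinate_in_Aplus by (metis bij_betw_imp_surj_on imageE)
  define h where "h = (\<lambda>w. f (on_axis k w))"
  have h_p: "h (p s) = s" if "norm s < 1" for s
    using fun_cong [OF f(2), of "on_axis k s"] on_axis_in_ballB [OF that, of k]
    by (simp add: h_def comp_op_def coordinate_def axis [OF that])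
  have hol_h: "h holomorphic_on ball 0 1"
    unfolding h_def
  proof (rule holomorphic_on_Aplus_comp [OF f(1)])
    show "(\<lambda>w. on_axis k w j) holomorphic_on ball 0 1" for j
      by (cases "j = k") (auto intro: holomorphic_intros)
  qed (use on_axis_in_ballB in auto)
  have h_0: "h 0 = 0"
    using h_p [of 0] p(2) by simp
  have h_le_1: "norm (h w) \<le> 1" if "norm w < 1" for w
    unfolding h_def
    by (rule norm_automorphism_preimage_coordinate_le_1
        [where f = f, OF aut f on_axis_in_ballB [OF that]])
  show ?thesis
    using Schwarz_Lemma_le [where h = h and B = 1, OF hol_h h_0 h_le_1 p(1) [OF t]]
    by (simp add: h_p [OF t])
qed

lemma
  fixes r c :: real
  assumes r: "0 < r" "r < 1" and "d \<ge> 1" "c \<le> 1" and le: "r \<le> r ^ d * c"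
  shows exponent_eq_1_if_le_power_mult: "d = 1"
    and factor_eq_1_if_le_power_mult: "c = 1"
proof -
  have "r ^ d * c \<le> r ^ d"
    using r \<open>c \<le> 1\<close> by (simp add: mult_left_le)
  with le have "r ^ 1 \<le> r ^ d"
    by simp
  then show "d = 1"
    using power_decreasing_iff [OF r] \<open>d \<ge> 1\<close> by (simp only: order.antisym)
  then show "c = 1"
    using le r \<open>c \<le> 1\<close> by simp
qed

lemma automorphism_coordinate_linear:
  assumes maps: "\<And>z. z \<in> ballB \<Longrightarrow> \<phi> z \<in> ballB"
    and aut: "Aplus_automorphism (comp_op \<phi>)"
    and zero: "\<And>z j. z \<in> ballB \<Longrightarrow> z j = 0 \<Longrightarrow> \<phi> z j = 0"
    and d: "d \<ge> 1" and u: "analytic_fun_B u"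
    and \<phi>_k: "\<And>z. z \<in> ballB \<Longrightarrow> \<phi> z k = z k ^ d * u z"
  obtains \<epsilon> where "norm \<epsilon> = 1" "\<And>z. z \<in> ballB \<Longrightarrow> \<phi> z k = \<epsilon> * z k"
proof -
  have \<phi>_lt_1: "norm (\<phi> z j) < 1" if "z \<in> ballB" for z j
    using maps [OF that] by (simp add: ballB_def)
  have u_le_1: "norm (u z) \<le> 1" if "z \<in> ballB" for z
  proof (rule norm_analytic_fun_B_le_if_norm_power_mult_le [OF u _ that])
    show "norm (z k ^ d * u z) \<le> 1" if "z \<in> ballB" for z
      using \<phi>_lt_1 [OF that, of k] \<phi>_k [OF that] by simp
  qed

  define x :: seq where "x = on_axis k (1 / 2)"
  have x: "x \<in> ballB"
    unfolding x_def by (rule on_axis_in_ballB) simp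
  have "norm (1 / 2 :: complex) \<le> norm (\<phi> (on_axis k (1 / 2)) k)"
  proof (rule automorphism_norm_le_on_axis [OF aut])
    show "\<phi> (on_axis k t) = on_axis k (\<phi> (on_axis k t) k)" if "norm t < 1" for t
      using zero [OF on_axis_in_ballB [OF that]] by (auto simp: fun_eq_iff)
    show "\<phi> (on_axis k 0) k = 0"
      using zero [OF on_axis_in_ballB, of 0 k] by simp
    show "norm (\<phi> (on_axis k t) k) < 1" if "norm t < 1" for t
      by (rule \<phi>_lt_1 [OF on_axis_in_ballB [OF that]])
  qed simp
  then have half_le: "1 / 2 \<le> (1 / 2) ^ d * norm (u x)"
    using \<phi>_k [OF x] by (simp add: x_def norm_mult norm_power norm_divide)
  have "d = 1"
    using exponent_eq_1_if_le_power_mult [OF _ _ d u_le_1 [OF x] half_le] by simp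
  have norm_u_x: "norm (u x) = 1"
    using factor_eq_1_if_le_power_mult [OF _ _ d u_le_1 [OF x] half_le] by simp
  show ?thesis
  proof (rule that [OF norm_u_x])
    fix z assume z: "z \<in> ballB"
    have "u z = u x"
      using u x z by (rule analytic_fun_B_maximum_modulus_principle) (simp add: norm_u_x u_le_1)
    then show "\<phi> z k = u x * z k"
      using \<phi>_k [OF z] by (simp add: \<open>d = 1\<close>)
  qed
qed

theorem theorem14:
  fixes \<phi> :: "seq \<Rightarrow> seq"
  assumes maps: "\<forall>z\<in>ballB. \<phi> z \<in> ballB"
    and anal: "analytic_map_B \<phi>"
    and inv: "\<forall>f\<in>Aplus. comp_op \<phi> f \<in> Aplus"
  shows
    "((\<exists>\<sigma> :: nat \<Rightarrow> nat. \<exists>\<epsilon> :: nat \<Rightarrow> complex. bij \<sigma> \<and> (\<forall>j. norm (\<epsilon> j) = 1) \<and>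
         (\<forall>z\<in>ballB. \<phi> z = (\<lambda>j. \<epsilon> j * z (\<sigma> j))))
       \<longrightarrow> Aplus_automorphism (comp_op \<phi>) \<and>
           (\<forall>f\<in>Aplus. Aplus_norm (comp_op \<phi> f) = Aplus_norm f))
   \<and>
    ((Aplus_automorphism (comp_op \<phi>) \<and>
      (\<forall>k. \<exists>d::nat. \<exists>u. d \<ge> 1 \<and> analytic_fun_B u \<and> u (\<lambda>j. 0) \<noteq> 0 \<and>
              (\<forall>z\<in>ballB. \<phi> z k = z k ^ d * u z)))
       \<longrightarrow> (\<exists>\<epsilon> :: nat \<Rightarrow> complex. (\<forall>j. norm (\<epsilon> j) = 1) \<and>
              (\<forall>z\<in>ballB. \<phi> z = (\<lambda>j. \<epsilon> j * z j))))"
proof (intro conjI impI; (elim conjE exE)?)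
  fix \<sigma> :: "nat \<Rightarrow> nat" and \<epsilon> :: "nat \<Rightarrow> complex"
  assume \<sigma>: "bij \<sigma>" and \<epsilon>: "\<forall>j. norm (\<epsilon> j) = 1"
    and \<phi>: "\<forall>z\<in>ballB. \<phi> z = (\<lambda>j. \<epsilon> j * z (\<sigma> j))"
  have "comp_op \<phi> = comp_op (weighted_perm \<sigma> \<epsilon>)"
    using \<phi> by (intro ext) (simp add: comp_op_def weighted_perm_def)
  then show "Aplus_automorphism (comp_op \<phi>)" "\<forall>f\<in>Aplus. Aplus_norm (comp_op \<phi> f) = Aplus_norm f"
    using \<sigma> \<epsilon> by (simp_all add: Aplus_automorphism_comp_weighted_perm Aplus_norm_comp_weighted_perm)
next
  assume aut: "Aplus_automorphism (comp_op \<phi>)"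
    and "\<forall>k. \<exists>d::nat. \<exists>u. d \<ge> 1 \<and> analytic_fun_B u \<and> u (\<lambda>j. 0) \<noteq> 0 \<and>
              (\<forall>z\<in>ballB. \<phi> z k = z k ^ d * u z)"
  then obtain d :: "nat \<Rightarrow> nat" and u where d: "\<And>k. d k \<ge> 1" and u: "\<And>k. analytic_fun_B (u k)"
    and \<phi>: "\<And>k z. z \<in> ballB \<Longrightarrow> \<phi> z k = z k ^ d k * u k z"
    by metis
  have zero: "\<phi> z j = 0" if "z \<in> ballB" "z j = 0" for z j
    using \<phi> [OF that(1), of j] that(2) d [of j] by simp
  have "\<exists>\<epsilon>. norm \<epsilon> = 1 \<and> (\<forall>z\<in>ballB. \<phi> z k = \<epsilon> * z k)" for k
    using automorphism_coordinate_linear [OF maps [rule_format] aut zero d u \<phi>] by metis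
  then show "\<exists>\<epsilon>. (\<forall>j. norm (\<epsilon> j) = 1) \<and> (\<forall>z\<in>ballB. \<phi> z = (\<lambda>j. \<epsilon> j * z j))"
    unfolding fun_eq_iff by metis
qed

end
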